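(* Let $\{a,b\}$ be an independent set in a graph $G$, let $u\in V(G)\setminus(C_{ab}(a)\cup C_{ab}(b))$, and let $(v_0,v_1,\ldots,v_k)$ be a minimum length $\{a,b\}$-chain to $u$. Let $$X=\begin{cases}C_{ab}(a)\cup C_{ab}(b)&\text{if }k=0,\\ R_{ab}(v_{k-1})&\text{otherwise,}\end{cases}$$ and let $Z=C_{ab}(a)\cup C_{ab}(b)\cup\{v_k\}\cup\bigcup_{i=1}^{k}R_{ab}(v_{i-1})$. Then there exists $y\in X$ such that $\{a,b\}\rightsquigarrow^{Z}_{1}\{v_k,y\}$ and $\{a,b\}\rightsquigarrow_{1}\{u,y\}$.
   Context: All graphs are finite, undirected and simple. When an independent set is written as $\{x,y\}$, $x$ and $y$ are understood to be distinct. $N(x)$ is the set of neighbours of $x$. Connected components are identified with their vertex sets. Components: for an independent set $\{a,b\}$ put $S=N(a)\cap N(b)$ and $G_{ab}=G-S$. For $x\in V(G_{ab})$, $C_{ab}(x)$ is the connected component of $G_{ab}$ containing $x$. For $x\in S$, $R_{ab}(x)$ is the connected component of $G-(S\setminus\{x\})$ containing $x$. For a connected component $C$ of $G_{ab}$ and $v\in S$: $v$ is adjacent to $C$ (equivalently, $C$ is adjacent to $v$) if some $w\in C$ satisfies $vw\in E(G)$; $v$ is avoided by $C$ ($C$ avoids $v$) if some $w\in C$ satisfies $vw\notin E(G)$. Chains: for $u\in V(G)\setminus(C_{ab}(a)\cup C_{ab}(b))$, a sequence $(v_0,v_1,\ldots,v_k)$ ($k\ge 0$) is an $\{a,b\}$-chain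 to $u$, of length $k$, if: (1) $v_i\in N(a)\cap N(b)$ for all $0\le i\le k$; (2) for each $1\le i\le k$, either $v_{i-1}v_i\notin E(G)$ or there is a connected component of $G_{ab}$ that is adjacent to $v_{i-1}$ and avoids $v_i$; (3) $v_0$ is avoided by $C_{ab}(a)$ or by $C_{ab}(b)$; (4) if $u\in N(a)\cap N(b)$ then $v_k=u$, and otherwise $v_k$ is adjacent to $C_{ab}(u)$. It is of minimum length if no $\{a,b\}$-chain to $u$ has smaller length. Token sliding: for independent sets $I,I'$, $I'$ is obtained from $I$ in one step if $I\setminus I'=\{p\}$, $I'\setminus I=\{q\}$ and $pq\in E(G)$ for some vertices $p,q$. For $Y\subseteq V(G)$ and a positive integer $t$, $I\rightsquigarrow^{Y}_{t}I'$ means that there is a sequence of independent sets $I=I_1,\ldots,I_k=I'$ ($k\ge1$), each obtained from the previous one in one step, such that $I_1\cup\cdots\cup I_k\subseteq Y$ and, with $I_0=\emptyset$, $\sum_{i=1}^{k}|(I_i\setminus I_{i-1})\cap\{x\}|\le t$ for every $x\in V(G)$. $I\rightsquigarrow_{t}I'$ means $I\rightsquigarrow^{V(G)}_{t}I'$. *)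

theory Defs
  imports "Graph_Theory.Digraph_Component"
begin

text \<open>
  Finite simple undirected graphs are the locale \<open>graph\<close>: finite loop-free symmetric digraphs
  without parallel arcs, so that \<open>x \<rightarrow>\<^bsub>G\<^esub> y\<close> says that \<open>xy\<close> is an edge. In such a graph strongly
  connected components are the connected components of the undirected graph.
\<close>

definition nbhd :: "('a,'b) pre_digraph \<Rightarrow> 'a \<Rightarrow> 'a set" where
  "nbhd G x = {y. x \<rightarrow>\<^bsub>G\<^esub> y}"

definition indep_set :: "('a,'b) pre_digraph \<Rightarrow> 'a set \<Rightarrow> bool" where
  "indep_set G I \<longleftrightarrow> I \<subseteq> verts G \<and> (\<forall>x\<in>I. \<forall>y\<in>I. \<not> x \<rightarrow>\<^bsub>G\<^esub> y)"

definition common_nbhd :: "('a,'b) pre_digraph \<Rightarrow> 'a \<Rightarrow> 'a \<Rightarrow> 'a set" where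
  "common_nbhd G a b = nbhd G a \<inter> nbhd G b"

definition G_del :: "('a,'b) pre_digraph \<Rightarrow> 'a \<Rightarrow> 'a \<Rightarrow> ('a,'b) pre_digraph" where
  "G_del G a b = G \<restriction> (verts G - common_nbhd G a b)"

definition C_comp :: "('a,'b) pre_digraph \<Rightarrow> 'a \<Rightarrow> 'a \<Rightarrow> 'a \<Rightarrow> 'a set" where
  "C_comp G a b x = pre_digraph.scc_of (G_del G a b) x"

text \<open>Used only for \<open>x \<in> common_nbhd G a b\<close>.\<close>

definition R_comp :: "('a,'b) pre_digraph \<Rightarrow> 'a \<Rightarrow> 'a \<Rightarrow> 'a \<Rightarrow> 'a set" where
  "R_comp G a b x = pre_digraph.scc_of (G \<restriction> (verts G - (common_nbhd G a b - {x}))) x"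

definition adjacent_to :: "('a,'b) pre_digraph \<Rightarrow> 'a \<Rightarrow> 'a set \<Rightarrow> bool" where
  "adjacent_to G v C \<longleftrightarrow> (\<exists>w\<in>C. v \<rightarrow>\<^bsub>G\<^esub> w)"

definition avoided_by :: "('a,'b) pre_digraph \<Rightarrow> 'a \<Rightarrow> 'a set \<Rightarrow> bool" where
  "avoided_by G v C \<longleftrightarrow> (\<exists>w\<in>C. \<not> v \<rightarrow>\<^bsub>G\<^esub> w)"

text \<open>
  \<open>chain G a b u v k\<close>: the sequence \<open>v 0, \<dots>, v k\<close> is an \<open>{a,b}\<close>-chain to \<open>u\<close>, of length \<open>k\<close>.
  It is meant for vertices \<open>u\<close> outside the components of \<open>a\<close> and \<open>b\<close>; values of \<open>v\<close> beyond \<open>k\<close>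
  are irrelevant.
\<close>

definition chain ::
  "('a,'b) pre_digraph \<Rightarrow> 'a \<Rightarrow> 'a \<Rightarrow> 'a \<Rightarrow> (nat \<Rightarrow> 'a) \<Rightarrow> nat \<Rightarrow> bool" where
  "chain G a b u v k \<longleftrightarrow>
     (\<forall>i\<le>k. v i \<in> nbhd G a \<inter> nbhd G b) \<and>
     (\<forall>i\<in>{1..k}. \<not> v (i - 1) \<rightarrow>\<^bsub>G\<^esub> v i \<or>
        (\<exists>C\<in>pre_digraph.sccs_verts (G_del G a b).
           adjacent_to G (v (i - 1)) C \<and> avoided_by G (v i) C)) \<and>
     (avoided_by G (v 0) (C_comp G a b a) \<or> avoided_by G (v 0) (C_comp G a b b)) \<and>
     (if u \<in> nbhd G a \<inter> nbhd G b then v k = u else adjacent_to G (v k) (C_comp G a b u))"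

definition min_length_chain ::
  "('a,'b) pre_digraph \<Rightarrow> 'a \<Rightarrow> 'a \<Rightarrow> 'a \<Rightarrow> (nat \<Rightarrow> 'a) \<Rightarrow> nat \<Rightarrow> bool" where
  "min_length_chain G a b u v k \<longleftrightarrow>
     chain G a b u v k \<and> (\<forall>v' k'. chain G a b u v' k' \<longrightarrow> k \<le> k')"

definition slide_step :: "('a,'b) pre_digraph \<Rightarrow> 'a set \<Rightarrow> 'a set \<Rightarrow> bool" where
  "slide_step G I I' \<longleftrightarrow> (\<exists>p q. I - I' = {p} \<and> I' - I = {q} \<and> p \<rightarrow>\<^bsub>G\<^esub> q)"

text \<open>
  \<open>slides_within G Y t I I'\<close> is \<open>I \<leadsto> I'\<close> with superscript \<open>Y\<close> and subscript \<open>t\<close>. The list \<open>Is\<close>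
  is \<open>I\<^sub>1, \<dots>, I\<^sub>k\<close>; prepending the empty set as \<open>I\<^sub>0\<close> makes \<open>({} # Is) ! i\<close> the set \<open>I\<^sub>i\<close>.
\<close>

definition slides_within ::
  "('a,'b) pre_digraph \<Rightarrow> 'a set \<Rightarrow> nat \<Rightarrow> 'a set \<Rightarrow> 'a set \<Rightarrow> bool" where
  "slides_within G Y t I I' \<longleftrightarrow>
     (\<exists>Is. Is \<noteq> [] \<and> hd Is = I \<and> last Is = I' \<and>
        (\<forall>J\<in>set Is. indep_set G J) \<and>
        (\<forall>i. Suc i < length Is \<longrightarrow> slide_step G (Is ! i) (Is ! Suc i)) \<and>
        \<Union> (set Is) \<subseteq> Y \<and>
        (\<forall>x\<in>verts G.
           (\<Sum>i = 1..length Is. card ((({} # Is) ! i - ({} # Is) ! (i - 1)) \<inter> {x})) \<le> t))"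

abbreviation slides :: "('a,'b) pre_digraph \<Rightarrow> nat \<Rightarrow> 'a set \<Rightarrow> 'a set \<Rightarrow> bool" where
  "slides G t I I' \<equiv> slides_within G (verts G) t I I'"

end

theory Submission
  imports Defs
begin

text \<open>
  Write \<open>S\<close> for the common neighbours of \<open>a\<close> and \<open>b\<close>, \<open>Cab\<close> for the union of the components of
  \<open>a\<close> and \<open>b\<close> in \<open>G - S\<close>, and \<open>U\<^sub>j\<close> for \<open>Cab\<close> together with the sets \<open>R(v\<^sub>i)\<close>, \<open>i < j\<close>. Each
  \<open>R(v\<^sub>i)\<close> consists of \<open>v\<^sub>i\<close> and the components of \<open>G - S\<close> adjacent to it, so \<open>U\<^sub>j\<close> is made of
  earlier chain vertices and whole components; a component outside \<open>U\<^sub>j\<close> is disjoint from \<open>U\<^sub>j\<close> and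
  has no edge to it (\<open>comp_outside_region\<close>).

  Minimality of the chain says that nothing can be skipped. Neither a start at \<open>v\<^sub>j\<^sub>+\<^sub>1\<close> nor a
  link from \<open>v\<^sub>i\<close> to \<open>v\<^sub>j\<^sub>+\<^sub>1\<close> with \<open>i < j\<close> is possible, which amounts to \<open>v\<^sub>j\<^sub>+\<^sub>1\<close> being adjacent
  to every vertex of \<open>U\<^sub>j\<close> (\<open>next_adjacent_region\<close>). The tokens therefore travel along the chain,
  one on \<open>v\<^sub>j\<close> and the other on some \<open>y\<close> in \<open>U\<^sub>j\<close>, and everything visited lies in
  \<open>U\<^sub>j \<union> {v\<^sub>j}\<close>. If \<open>v\<^sub>j\<close> and \<open>v\<^sub>j\<^sub>+\<^sub>1\<close> are nonadjacent, \<open>y\<close> slides to \<open>v\<^sub>j\<^sub>+\<^sub>1\<close>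
  directly. Otherwise a component \<open>C\<close> adjacent to \<open>v\<^sub>j\<close> avoids \<open>v\<^sub>j\<^sub>+\<^sub>1\<close>. It is not inside
  \<open>U\<^sub>j\<close>, hence unvisited and free of neighbours of \<open>y\<close>; the token on \<open>v\<^sub>j\<close> slides within \<open>C\<close> to a
  non-neighbour of \<open>v\<^sub>j\<^sub>+\<^sub>1\<close>, and then \<open>y\<close> slides to \<open>v\<^sub>j\<^sub>+\<^sub>1\<close> (\<open>slide_to_chain_vertex\<close>). At the
  end, if \<open>u\<close> is not \<open>v\<^sub>k\<close> itself, its component is adjacent to no \<open>v\<^sub>i\<close> with \<open>i < k\<close>, again by
  minimality. So it lies outside \<open>U\<^sub>k\<close>, and the token on \<open>v\<^sub>k\<close> slides through it to \<open>u\<close>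
  (\<open>slide_to_u\<close>).

  To begin, a shortest path inside \<open>Cab\<close> from \<open>{a, b}\<close> to a non-neighbour of \<open>v\<^sub>0\<close> is followed by
  the token at its first vertex, and then the other token slides to \<open>v\<^sub>0\<close>; minimality of the path
  keeps the two tokens nonadjacent (\<open>slide_onto_common_neighbour\<close>).

  Every single move enters a vertex that no token has visited, so the bound of one visit per vertex
  never has to be counted again once \<open>slides_within_fresh_step\<close> is available.
\<close>

section \<open>Sliding one token along fresh vertices\<close>

lemma slides_within_mono:
  assumes "slides_within G Y t I J" "Y \<subseteq> Y'"
  shows "slides_within G Y' t I J"
  using assms unfolding slides_within_def by blast

lemma slides_within_final:
  assumes "slides_within G Y t I J"
  shows "J \<subseteq> Y" "indep_set G J"
  using assms last_in_set unfolding slides_within_def by (metis Sup_le_iff, metis)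

lemma slides_within_verts:
  assumes "slides_within G Y t I J"
  shows "slides G t I J"
proof -
  have "\<Union> (set Is) \<subseteq> verts G" if "\<forall>J\<in>set Is. indep_set G J" for Is
    using that unfolding indep_set_def by blast
  with assms show ?thesis
    unfolding slides_within_def by (elim ex_forward) simp
qed

lemma slides_within_refl:
  assumes "indep_set G I" "t \<ge> 1"
  shows "slides_within G I t I I"
proof -
  have "card (I \<inter> {x}) \<le> t" for x
    using assms(2) card_mono[of "{x}" "I \<inter> {x}"] by simp
  then show ?thesis
    unfolding slides_within_def using assms(1) by (intro exI[of _ "[I]"]) simp
qed

text \<open>
  The visits to a vertex other than \<open>q\<close> do not change, and \<open>q\<close> gets its first visit because all
  earlier sets lie in \<open>Y\<close>. Moving only to vertices outside \<open>Y\<close> thus replaces all bookkeeping of the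
  visit numbers by bookkeeping of the set of visited vertices.
\<close>

lemma slides_within_fresh_step:
  assumes IJ: "slides_within G Y 1 I J"
    and K: "indep_set G K" "slide_step G J K" "K - J = {q}"
    and q: "q \<notin> Y"
  shows "slides_within G (insert q Y) 1 I K"
proof -
  from IJ obtain Is where Is: "Is \<noteq> []" "hd Is = I" "last Is = J" "\<forall>J\<in>set Is. indep_set G J"
      "\<forall>i. Suc i < length Is \<longrightarrow> slide_step G (Is ! i) (Is ! Suc i)" "\<Union> (set Is) \<subseteq> Y"
      "\<And>x. x \<in> verts G \<Longrightarrow>
        (\<Sum>i = 1..length Is. card ((({} # Is) ! i - ({} # Is) ! (i - 1)) \<inter> {x})) \<le> 1"
    unfolding slides_within_def by blast
  let ?Js = "Is @ [K]"
  let ?new = "\<lambda>Ls x i. card ((({} # Ls) ! i - ({} # Ls) ! (i - 1)) \<inter> {x})"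
  have old: "({} # ?Js) ! i = ({} # Is) ! i" if "i \<le> length Is" for i
    using that by (metis append_Cons le_imp_less_Suc length_Cons nth_append)
  have J: "({} # Is) ! length Is = J"
    using Is(1,3) by (metis last_ConsR last_conv_nth length_Cons list.discI diff_Suc_1)
  have "(\<Sum>i = 1..length ?Js. ?new ?Js x i) \<le> 1" if x: "x \<in> verts G" for x
  proof -
    have "(\<Sum>i = 1..length ?Js. ?new ?Js x i)
        = (\<Sum>i = 1..length Is. ?new ?Js x i) + card ((K - J) \<inter> {x})"
      using J old[of "length Is"] by simp
    also have "(\<Sum>i = 1..length Is. ?new ?Js x i) = (\<Sum>i = 1..length Is. ?new Is x i)"
    proof (intro sum.cong refl)
      fix i assume "i \<in> {1..length Is}"
      then have "i \<le> length Is" "i - 1 \<le> length Is"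
        by auto
      then show "?new ?Js x i = ?new Is x i"
        by (simp only: old)
    qed
    finally have split: "(\<Sum>i = 1..length ?Js. ?new ?Js x i)
        = (\<Sum>i = 1..length Is. ?new Is x i) + card ({q} \<inter> {x})"
      using K(3) by simp
    show ?thesis
    proof (cases "x = q")
      case True
      have "?new Is x i = 0" if "i \<in> {1..length Is}" for i
      proof -
        have "({} # Is) ! i \<in> set Is"
          using that by (cases i) auto
        then have "({} # Is) ! i \<subseteq> Y"
          using Is(6) by blast
        then show ?thesis
          using q True by auto
      qed
      then show ?thesis
        using split True by simp
    next
      case False
      then show ?thesis
        using split Is(7)[OF x] by simp
    qed
  qed
  moreover have "slide_step G (?Js ! i) (?Js ! Suc i)" if "Suc i < length ?Js" for i
  proof (cases "Suc i < length Is")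
    case True
    then show ?thesis
      using Is(5) by (simp add: nth_append)
  next
    case False
    then have i: "Suc i = length Is"
      using that by simp
    then have "?Js ! i = J"
      using Is(1,3) by (metis diff_Suc_1 last_conv_nth lessI nth_append)
    then show ?thesis
      using K(2) i by (simp add: nth_append)
  qed
  moreover have "K \<subseteq> insert q Y"
    using K(3) slides_within_final(1)[OF IJ] by blast
  then have "\<Union> (set ?Js) \<subseteq> insert q Y"
    using Is(6) by auto
  ultimately show ?thesis
    unfolding slides_within_def using Is K(1)
    by (intro exI[of _ ?Js]) (simp add: hd_append)
qed

lemma (in graph) slides_within_move_token:
  assumes IJ: "slides_within G Y 1 I {p, y}" and "p \<noteq> y"
    and q: "p \<rightarrow>\<^bsub>G\<^esub> q" "q \<notin> Y" "\<not> y \<rightarrow>\<^bsub>G\<^esub> q"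
  shows "slides_within G (insert q Y) 1 I {q, y}"
proof (rule slides_within_fresh_step[OF IJ])
  have py: "p \<in> Y" "y \<in> Y" "indep_set G {p, y}"
    using slides_within_final[OF IJ] by auto
  then have neq: "q \<noteq> p" "q \<noteq> y"
    using q(2) by auto
  show "indep_set G {q, y}"
    using py(3) q adj_in_verts[OF q(1)] graph_symmetric adj_not_same
    unfolding indep_set_def by blast
  show "slide_step G {p, y} {q, y}"
    unfolding slide_step_def using neq \<open>p \<noteq> y\<close> q(1) by (intro exI[of _ p] exI[of _ q]) auto
  show "{q, y} - {p, y} = {q}"
    using neq by auto
qed (use q in auto)

lemma (in graph) slides_within_along_path:
  assumes start: "slides_within G Y 1 I {f 0, y}" and "f 0 \<noteq> y"
    and path: "\<And>i. i < n \<Longrightarrow> f i \<rightarrow>\<^bsub>G\<^esub> f (Suc i)" "inj_on f {..n}"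
    and fresh: "\<And>i. 1 \<le> i \<Longrightarrow> i \<le> n \<Longrightarrow> f i \<notin> Y \<and> \<not> y \<rightarrow>\<^bsub>G\<^esub> f i"
  shows "slides_within G (Y \<union> f ` {1..n}) 1 I {f n, y}"
  using path fresh
proof (induction n)
  case 0
  then show ?case
    using start by simp
next
  case (Suc n)
  have IH: "slides_within G (Y \<union> f ` {1..n}) 1 I {f n, y}"
    using Suc.prems by (intro Suc.IH) (auto intro: inj_on_subset)
  have y: "y \<in> Y"
    using slides_within_final(1)[OF start] by simp
  have "f n \<noteq> y"
    using y \<open>f 0 \<noteq> y\<close> Suc.prems(3)[of n] by (cases n) auto
  moreover have "f (Suc n) \<notin> f ` {1..n}"
    using inj_on_eq_iff[OF Suc.prems(2)] by fastforce
  ultimately have "slides_within G (insert (f (Suc n)) (Y \<union> f ` {1..n})) 1 I {f (Suc n), y}"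
    using Suc.prems by (intro slides_within_move_token[OF IH]) auto
  then show ?case
    by (simp add: atLeastAtMostSuc_conv)
qed

section \<open>Shortest paths\<close>

text \<open>
  Take a walk from \<open>A\<close> to \<open>W\<close> with the fewest steps. Replacing its part before position \<open>i\<close> by any
  other walk from a member of \<open>A\<close> cannot save a step. This cutting property is exported, since it
  yields more than injectivity: with \<open>m = 0\<close> the path leaves \<open>A\<close> for good, and with \<open>m = 1\<close>
  only its first two vertices can be successors of members of \<open>A\<close>.
\<close>

lemma shortest_path_between_sets:
  assumes "x \<in> A" "y \<in> W" "(x, y) \<in> r\<^sup>*"
  obtains f n where "f 0 \<in> A" "f n \<in> W" "\<And>i. i < n \<Longrightarrow> (f i, f (Suc i)) \<in> r"
    "\<And>i c m. i \<le> n \<Longrightarrow> c \<in> A \<Longrightarrow> (c, f i) \<in> r ^^ m \<Longrightarrow> i \<le> m"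
    "inj_on f {..n}"
proof -
  define P where "P n \<longleftrightarrow> (\<exists>x\<in>A. \<exists>y\<in>W. (x, y) \<in> r ^^ n)" for n
  have "\<exists>n. P n"
    using assms rtrancl_imp_relpow unfolding P_def by metis
  then have n: "P (LEAST n. P n)" and least: "\<And>m. P m \<Longrightarrow> (LEAST n. P n) \<le> m"
    by (metis LeastI, metis Least_le)
  define n where "n = (LEAST n. P n)"
  from n obtain f where f: "f 0 \<in> A" "f n \<in> W" "\<And>i. i < n \<Longrightarrow> (f i, f (Suc i)) \<in> r"
    unfolding n_def[symmetric] unfolding P_def relpow_fun_conv by blast
  have seg: "(f i, f (i + d)) \<in> r ^^ d" if "i + d \<le> n" for i d
    unfolding relpow_fun_conv using that f(3) by (intro exI[of _ "\<lambda>j. f (i + j)"]) simp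
  have cut: "i \<le> m" if "i \<le> n" "c \<in> A" "(c, f i) \<in> r ^^ m" for i c m
  proof -
    have "(c, f n) \<in> r ^^ (m + (n - i))"
      using that(1,3) seg[of i "n - i"] unfolding relpow_add by auto
    then have "n \<le> m + (n - i)"
      using least f(2) that(2) unfolding n_def P_def by blast
    then show ?thesis
      using that(1) by simp
  qed
  have "i \<le> j" if "i \<le> n" "j \<le> n" "f i = f j" for i j
    using cut[OF that(1) f(1)] seg[of 0 j] that by simp
  then have "inj_on f {..n}"
    by (auto intro!: inj_onI le_antisym)
  then show ?thesis
    using that f cut by blast
qed

section \<open>Components\<close>

locale nonadjacent_pair = graph G for G :: "('a,'b) pre_digraph" +
  fixes a b :: 'a
  assumes a_neq_b: "a \<noteq> b" and indep_ab: "indep_set G {a, b}"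
begin

abbreviation "S \<equiv> common_nbhd G a b"
abbreviation "comps \<equiv> pre_digraph.sccs_verts (G_del G a b)"

lemma adj_sym: "x \<rightarrow>\<^bsub>G\<^esub> y \<Longrightarrow> y \<rightarrow>\<^bsub>G\<^esub> x"
  by (rule graph_symmetric)

lemma ab_verts: "a \<in> verts G" "b \<in> verts G" "\<not> a \<rightarrow>\<^bsub>G\<^esub> b" "\<not> b \<rightarrow>\<^bsub>G\<^esub> a"
  using indep_ab unfolding indep_set_def by auto

lemma S_iff: "x \<in> S \<longleftrightarrow> a \<rightarrow>\<^bsub>G\<^esub> x \<and> b \<rightarrow>\<^bsub>G\<^esub> x"
  unfolding common_nbhd_def nbhd_def by simp

lemma ab_not_in_S: "a \<notin> S" "b \<notin> S"
  using ab_verts by (simp_all add: S_iff)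

lemma S_subset_verts: "S \<subseteq> verts G"
  using adj_in_verts S_iff by blast

lemma adj_induce_iff:
  "x \<rightarrow>\<^bsub>G \<restriction> H\<^esub> y \<longleftrightarrow> x \<rightarrow>\<^bsub>G\<^esub> y \<and> x \<in> H \<and> y \<in> H"
  by (auto simp: arcs_ends_conv)

lemma sym_digraph_induce:
  assumes "H \<subseteq> verts G"
  shows "sym_digraph (G \<restriction> H)"
proof -
  interpret H: wf_digraph "G \<restriction> H" by (rule wellformed_induce_subgraph)
  show ?thesis
    using adj_sym by (intro H.sym_digraphI) (auto simp: symmetric_def sym_def adj_induce_iff)
qed

sublocale D: sym_digraph "G_del G a b"
  unfolding G_del_def by (rule sym_digraph_induce) blast

lemma D_adj_iff: "x \<rightarrow>\<^bsub>G_del G a b\<^esub> y \<longleftrightarrow> x \<rightarrow>\<^bsub>G\<^esub> y \<and> x \<notin> S \<and> y \<notin> S"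
  unfolding G_del_def using adj_in_verts by (auto simp: adj_induce_iff)

lemma D_verts: "verts (G_del G a b) = verts G - S"
  by (simp add: G_del_def)

lemma comp_subset: "C \<in> comps \<Longrightarrow> C \<subseteq> verts G - S"
  using D.sccs_verts_subsets D_verts by blast

lemma comp_eqI: "C \<in> comps \<Longrightarrow> D \<in> comps \<Longrightarrow> x \<in> C \<Longrightarrow> x \<in> D \<Longrightarrow> C = D"
  using D.sccs_verts_disjoint by blast

lemma C_comp_in_comps:
  assumes "x \<in> verts G - S"
  shows "C_comp G a b x \<in> comps" "x \<in> C_comp G a b x"
  using assms D.scc_of_in_sccs_verts D.in_scc_of_self unfolding C_comp_def D_verts by auto

lemma comp_closed:
  assumes C: "C \<in> comps" and "x \<in> C" "x \<rightarrow>\<^bsub>G\<^esub> y" "y \<notin> S"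
  shows "y \<in> C"
proof -
  have "x \<rightarrow>\<^bsub>G_del G a b\<^esub> y"
    using assms comp_subset[OF C] by (auto simp: D_adj_iff)
  then have "x \<rightarrow>\<^sup>*\<^bsub>G_del G a b\<^esub> y" "y \<rightarrow>\<^sup>*\<^bsub>G_del G a b\<^esub> x"
    using D.graph_symmetric by auto
  then show ?thesis
    using C \<open>x \<in> C\<close> unfolding D.in_sccs_verts_conv_reachable by blast
qed

lemma comp_connected:
  assumes C: "C \<in> comps" and "x \<in> C" "y \<in> C"
  shows "(x, y) \<in> {(x, y). x \<rightarrow>\<^bsub>G\<^esub> y \<and> y \<in> C}\<^sup>*"
proof -
  have "x \<rightarrow>\<^sup>*\<^bsub>G_del G a b\<^esub> y"
    using assms unfolding D.in_sccs_verts_conv_reachable by blast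
  then have "(x, y) \<in> {(x, y). x \<rightarrow>\<^bsub>G\<^esub> y \<and> y \<in> C}\<^sup>* \<and> y \<in> C"
  proof (induction rule: D.reachable_induct)
    case base
    show ?case
      using \<open>x \<in> C\<close> by simp
  next
    case (step z w)
    then have "w \<in> C"
      using comp_closed[OF C] by (metis D_adj_iff)
    with step show ?case
      by (auto simp: D_adj_iff intro: rtrancl_into_rtrancl)
  qed
  then show ?thesis ..
qed

text \<open>
  The next two lemmas describe \<open>R_comp\<close> as \<open>x\<close> together with the components adjacent to \<open>x\<close>: a
  walk avoiding \<open>S - {x}\<close> can change the component of \<open>G - S\<close> only by passing through \<open>x\<close>.
\<close>

lemma R_comp_cases:
  assumes "x \<in> S" "z \<in> R_comp G a b x"
  obtains "z = x" | C where "C \<in> comps" "z \<in> C" "adjacent_to G x C"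
proof -
  let ?H = "verts G - (S - {x})"
  interpret R: sym_digraph "G \<restriction> ?H"
    by (rule sym_digraph_induce) blast
  have "x \<rightarrow>\<^sup>*\<^bsub>G \<restriction> ?H\<^esub> z"
    using assms(2) unfolding R_comp_def R.scc_of_def by simp
  then have "z = x \<or> (\<exists>C\<in>comps. z \<in> C \<and> adjacent_to G x C)"
  proof (induction rule: R.reachable_induct)
    case base
    then show ?case by simp
  next
    case (step z w)
    have w: "z \<rightarrow>\<^bsub>G\<^esub> w" "w = x \<or> w \<notin> S" "w \<in> verts G"
      using step.hyps(2) adj_in_verts by (auto simp: adj_induce_iff)
    show ?case
    proof (cases "w = x \<or> z = x")
      case True
      then show ?thesis
        using w C_comp_in_comps[of w] unfolding adjacent_to_def by blast
    next
      case False
      then show ?thesis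
        using step.IH w comp_closed by blast
    qed
  qed
  then show ?thesis
    using that by blast
qed

lemma R_comp_contains:
  assumes "x \<in> S"
  shows "x \<in> R_comp G a b x"
    and "C \<in> comps \<Longrightarrow> adjacent_to G x C \<Longrightarrow> C \<subseteq> R_comp G a b x"
proof -
  let ?H = "verts G - (S - {x})"
  interpret R: sym_digraph "G \<restriction> ?H"
    by (rule sym_digraph_induce) blast
  have xH: "x \<in> ?H"
    using assms S_subset_verts by blast
  show "x \<in> R_comp G a b x"
    unfolding R_comp_def using xH by (simp add: R.in_scc_of_self)
  assume C: "C \<in> comps" and "adjacent_to G x C"
  then obtain d where d: "d \<in> C" "x \<rightarrow>\<^bsub>G\<^esub> d"
    unfolding adjacent_to_def by blast
  have CH: "C \<subseteq> ?H"
    using comp_subset[OF C] by blast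
  show "C \<subseteq> R_comp G a b x"
  proof
    fix w assume "w \<in> C"
    from comp_connected[OF C d(1) this] have "x \<rightarrow>\<^sup>*\<^bsub>G \<restriction> ?H\<^esub> w \<and> w \<in> C"
    proof (induction rule: rtrancl_induct)
      case base
      then show ?case
        using d xH CH by (auto simp: adj_induce_iff intro!: R.reachable_adjI)
    next
      case (step z w)
      then have "z \<rightarrow>\<^bsub>G \<restriction> ?H\<^esub> w"
        using CH by (auto simp: adj_induce_iff)
      then show ?case
        using step R.reachable_adj_trans by blast
    qed
    then show "w \<in> R_comp G a b x"
      unfolding R_comp_def by (simp add: R.scc_ofI_reachable')
  qed
qed

section \<open>Moving a token into a component\<close>

lemma move_token_into_comp:
  assumes slides: "slides_within G Y 1 I {p, y}" and "p \<noteq> y"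
    and C: "C \<in> comps" "C \<inter> Y = {}" "\<not> adjacent_to G y C" "adjacent_to G p C" and w: "w \<in> C"
  shows "slides_within G (Y \<union> C) 1 I {w, y}"
proof -
  let ?r = "{(x, y). x \<rightarrow>\<^bsub>G\<^esub> y \<and> y \<in> C}"
  obtain d where d: "d \<in> C" "p \<rightarrow>\<^bsub>G\<^esub> d"
    using C(4) unfolding adjacent_to_def by blast
  have "(p, w) \<in> ?r\<^sup>*"
    using d comp_connected[OF C(1) d(1) w] by (auto intro: converse_rtrancl_into_rtrancl)
  then obtain f n where f: "f 0 \<in> {p}" "f n \<in> {w}" "\<And>i. i < n \<Longrightarrow> (f i, f (Suc i)) \<in> ?r"
    "inj_on f {..n}"
    by (rule shortest_path_between_sets[of p "{p}" w "{w}", rotated 2]) auto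
  have inC: "f i \<in> C" if "1 \<le> i" "i \<le> n" for i
    using f(3)[of "i - 1"] that by auto
  have "slides_within G (Y \<union> f ` {1..n}) 1 I {f n, y}"
  proof (rule slides_within_along_path)
    show "slides_within G Y 1 I {f 0, y}" "f 0 \<noteq> y"
      using slides f(1) \<open>p \<noteq> y\<close> by auto
    show "f i \<notin> Y \<and> \<not> y \<rightarrow>\<^bsub>G\<^esub> f i" if "1 \<le> i" "i \<le> n" for i
      using inC[OF that] C(2,3) unfolding adjacent_to_def by blast
  qed (use f in auto)
  moreover have "Y \<union> f ` {1..n} \<subseteq> Y \<union> C"
    using inC by auto
  ultimately show ?thesis
    using f(2) slides_within_mono by fastforce
qed

abbreviation "Cab \<equiv> C_comp G a b a \<union> C_comp G a b b"

lemma Cab_comps: "C_comp G a b a \<in> comps" "C_comp G a b b \<in> comps"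
  and ab_in_Cab: "a \<in> C_comp G a b a" "b \<in> C_comp G a b b"
  using C_comp_in_comps ab_verts ab_not_in_S by auto

lemma Cab_disjoint_S: "Cab \<inter> S = {}"
  using Cab_comps comp_subset by blast

text \<open>
  The components of \<open>a\<close> and \<open>b\<close> may coincide, so a token leaving \<open>a\<close> could run into a neighbour of
  \<open>b\<close>. Measuring the distance to a non-neighbour of \<open>s\<close> from \<open>a\<close> and \<open>b\<close> simultaneously excludes
  this: beyond its second vertex a shortest path meets no neighbour of the token \<open>d\<close> that stays, and
  a second vertex adjacent to \<open>d\<close> would be a common neighbour of \<open>a\<close> and \<open>b\<close>.
\<close>

lemma slide_onto_common_neighbour:
  assumes s: "s \<in> S" and avoid: "avoided_by G s (C_comp G a b a) \<or> avoided_by G s (C_comp G a b b)"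
  shows "\<exists>y\<in>Cab. slides_within G (insert s Cab) 1 {a, b} {s, y}"
proof -
  let ?r = "{(x, y). x \<rightarrow>\<^bsub>G\<^esub> y \<and> y \<in> Cab}"
  let ?W = "{w \<in> Cab. \<not> s \<rightarrow>\<^bsub>G\<^esub> w}"
  obtain x w where xw: "x \<in> {a, b}" "w \<in> ?W" "(x, w) \<in> ?r\<^sup>*"
  proof -
    obtain x w where x: "x \<in> {a, b}" and w: "w \<in> C_comp G a b x" "\<not> s \<rightarrow>\<^bsub>G\<^esub> w"
      using avoid unfolding avoided_by_def by blast
    have sub: "C_comp G a b x \<subseteq> Cab"
      using x by blast
    have "(x, w) \<in> {(y, z). y \<rightarrow>\<^bsub>G\<^esub> z \<and> z \<in> C_comp G a b x}\<^sup>*"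
      using x w(1) Cab_comps ab_in_Cab by (intro comp_connected) auto
    moreover have "{(y, z). y \<rightarrow>\<^bsub>G\<^esub> z \<and> z \<in> C_comp G a b x} \<subseteq> ?r"
      using sub by auto
    ultimately have "(x, w) \<in> ?r\<^sup>*"
      using rtrancl_mono by blast
    moreover have "w \<in> ?W"
      using w sub by blast
    ultimately show thesis
      using that x by blast
  qed
  obtain f n where f: "f 0 \<in> {a, b}" "f n \<in> ?W" "\<And>i. i < n \<Longrightarrow> (f i, f (Suc i)) \<in> ?r"
    and cut: "\<And>i c m. i \<le> n \<Longrightarrow> c \<in> {a, b} \<Longrightarrow> (c, f i) \<in> ?r ^^ m \<Longrightarrow> i \<le> m"
    and inj: "inj_on f {..n}"
    by (rule shortest_path_between_sets[OF xw]) (rule that)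
  obtain d where d: "{a, b} = {f 0, d}" "f 0 \<noteq> d"
    using f(1) a_neq_b by auto
  have inU: "f i \<in> Cab" if "1 \<le> i" "i \<le> n" for i
    using f(3)[of "i - 1"] that by auto
  have fresh: "f i \<notin> {a, b}" if "1 \<le> i" "i \<le> n" for i
    using cut[of i "f i" 0] that by auto
  have nadj: "\<not> d \<rightarrow>\<^bsub>G\<^esub> f i" if "1 \<le> i" "i \<le> n" for i
  proof
    assume di: "d \<rightarrow>\<^bsub>G\<^esub> f i"
    then have "i = 1"
      using cut[of i d 1] d inU[OF that] that by auto
    then have "f 0 \<rightarrow>\<^bsub>G\<^esub> f i"
      using f(3)[of 0] that by auto
    then have "f i \<in> S"
      using di d by (auto simp: S_iff doubleton_eq_iff)
    then show False
      using Cab_disjoint_S inU[OF that] by blast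
  qed
  have "slides_within G {a, b} 1 {a, b} {f 0, d}"
    using slides_within_refl[OF indep_ab] d by simp
  then have "slides_within G ({a, b} \<union> f ` {1..n}) 1 {a, b} {f n, d}"
    using f(3) inj fresh nadj d(2) by (intro slides_within_along_path) auto
  moreover have "f ` {1..n} \<subseteq> Cab"
    by (intro image_subsetI inU) auto
  then have "{a, b} \<union> f ` {1..n} \<subseteq> Cab"
    using ab_in_Cab by blast
  ultimately have "slides_within G Cab 1 {a, b} {f n, d}"
    by (rule slides_within_mono)
  then have at_w: "slides_within G Cab 1 {a, b} {d, f n}"
    by (simp only: insert_commute)
  have "d \<noteq> f n"
    using fresh[of n] d by (cases n) auto
  moreover have "d \<rightarrow>\<^bsub>G\<^esub> s"
    using s d by (auto simp: S_iff doubleton_eq_iff)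
  moreover have "s \<notin> Cab"
    using s Cab_disjoint_S by blast
  moreover have "\<not> f n \<rightarrow>\<^bsub>G\<^esub> s"
    using f(2) adj_sym by blast
  ultimately have "slides_within G (insert s Cab) 1 {a, b} {s, f n}"
    by (intro slides_within_move_token[OF at_w])
  then show ?thesis
    using f(2) by blast
qed

section \<open>Regions\<close>

definition region :: "'a set \<Rightarrow> 'a set" where
  "region V = Cab \<union> (\<Union>x\<in>V. R_comp G a b x)"

lemma region_cases:
  assumes "V \<subseteq> S" "y \<in> region V"
  obtains "y \<in> V"
  | D where "D \<in> comps" "y \<in> D" "D \<subseteq> region V"
      "D = C_comp G a b a \<or> D = C_comp G a b b \<or> (\<exists>x\<in>V. adjacent_to G x D)"
proof -
  consider "y \<in> Cab" | x where "x \<in> V" "y \<in> R_comp G a b x"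
    using assms(2) unfolding region_def by blast
  then show ?thesis
  proof cases
    case 1
    then show ?thesis
      using that(2) Cab_comps unfolding region_def by blast
  next
    case 2
    then have "x \<in> S"
      using assms(1) by blast
    from this 2(2) show ?thesis
    proof (cases rule: R_comp_cases)
      case 1
      then show ?thesis
        using that(1) \<open>x \<in> V\<close> by blast
    next
      case (2 D)
      then show ?thesis
        using that(2)[of D] R_comp_contains(2)[OF \<open>x \<in> S\<close>] \<open>x \<in> V\<close> unfolding region_def by blast
    qed
  qed
qed

text \<open>
  A vertex \<open>y\<close> of \<open>V\<close> has edges only to components that its \<open>R_comp\<close> contains, and any other vertex
  of the region has no neighbour in a component different from its own.
\<close>

lemma comp_outside_region:
  assumes V: "V \<subseteq> S" and C: "C \<in> comps" "\<not> C \<subseteq> region V"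
  shows "C \<inter> region V = {}" and "y \<in> region V \<Longrightarrow> \<not> adjacent_to G y C"
proof -
  have "z \<notin> C" if "z \<in> region V" for z
    using V that
  proof (cases rule: region_cases)
    case 1
    then show ?thesis
      using V comp_subset[OF C(1)] by blast
  next
    case (2 D)
    then show ?thesis
      using C comp_eqI by blast
  qed
  then show "C \<inter> region V = {}"
    by blast
  assume "y \<in> region V"
  with V show "\<not> adjacent_to G y C"
  proof (cases rule: region_cases)
    case 1
    then show ?thesis
      using R_comp_contains(2)[of y C] V C unfolding region_def by blast
  next
    case (2 D)
    show ?thesis
    proof
      assume "adjacent_to G y C"
      then obtain w where w: "w \<in> C" "y \<rightarrow>\<^bsub>G\<^esub> w"
        unfolding adjacent_to_def by blast
      then have "w \<in> D"
        using comp_closed[OF 2(1,2)] comp_subset[OF C(1)] by blast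
      then show False
        using C 2 comp_eqI w(1) by blast
    qed
  qed
qed

section \<open>Minimum length chains\<close>

text \<open>
  The second and third conditions on a chain are named separately because minimality denies further
  instances of them.
\<close>

definition link :: "'a \<Rightarrow> 'a \<Rightarrow> bool" where
  "link x y \<longleftrightarrow> \<not> x \<rightarrow>\<^bsub>G\<^esub> y \<or> (\<exists>C\<in>comps. adjacent_to G x C \<and> avoided_by G y C)"

definition start :: "'a \<Rightarrow> bool" where
  "start x \<longleftrightarrow> avoided_by G x (C_comp G a b a) \<or> avoided_by G x (C_comp G a b b)"

lemma chain_iff:
  "chain G a b u v k \<longleftrightarrow>
     (\<forall>i\<le>k. v i \<in> S) \<and> (\<forall>i<k. link (v i) (v (Suc i))) \<and> start (v 0) \<and>
     (if u \<in> S then v k = u else adjacent_to G (v k) (C_comp G a b u))"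
proof -
  have "{1..k} = Suc ` {..<k}"
    by (simp add: image_Suc_lessThan)
  then have "(\<forall>i\<in>{1..k}. P (i - 1) i) \<longleftrightarrow> (\<forall>i<k. P i (Suc i))" for P :: "nat \<Rightarrow> nat \<Rightarrow> bool"
    by auto
  from this[of "\<lambda>i j. link (v i) (v j)"] show ?thesis
    unfolding chain_def link_def start_def common_nbhd_def by simp
qed

end

locale min_chain = nonadjacent_pair +
  fixes u :: 'a and v :: "nat \<Rightarrow> 'a" and k :: nat
  assumes u: "u \<in> verts G - Cab" and min_length: "min_length_chain G a b u v k"
begin

lemma is_chain: "chain G a b u v k"
  using min_length unfolding min_length_chain_def by blast

lemma v_in_S: "i \<le> k \<Longrightarrow> v i \<in> S"
  and link_v: "i < k \<Longrightarrow> link (v i) (v (Suc i))"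
  and start_v: "start (v 0)"
  using is_chain unfolding chain_iff by blast+

lemma no_shorter_chain: "m < k \<Longrightarrow> \<not> chain G a b u w m"
  using min_length unfolding min_length_chain_def by (meson not_le)

text \<open>
  In the next three lemmas the forbidden relation would shorten the chain: by dropping a beginning,
  a middle part, or an end.
\<close>

lemma not_start:
  assumes "0 < j" "j \<le> k"
  shows "\<not> start (v j)"
proof
  assume "start (v j)"
  then have "chain G a b u (\<lambda>i. v (i + j)) (k - j)"
    using is_chain assms unfolding chain_iff by auto
  then show False
    using no_shorter_chain[of "k - j"] assms by simp
qed

lemma not_link:
  assumes "Suc i < j" "j \<le> k"
  shows "\<not> link (v i) (v j)"
proof
  assume ij: "link (v i) (v j)"
  define d where "d = j - Suc i"
  have d: "d > 0" "Suc i + d = j"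
    using assms unfolding d_def by auto
  define w where "w m = (if m \<le> i then v m else v (m + d))" for m
  have "link (w m) (w (Suc m))" if "m < k - d" for m
  proof -
    consider "m < i" | "m = i" | "i < m" by linarith
    then show ?thesis
      using ij link_v[of m] link_v[of "m + d"] that d assms unfolding w_def by cases auto
  qed
  then have "chain G a b u w (k - d)"
    using is_chain d assms unfolding chain_iff w_def by auto
  then show False
    using no_shorter_chain[of "k - d"] d assms by simp
qed

lemma not_end:
  assumes "i < k" "u \<notin> S"
  shows "\<not> adjacent_to G (v i) (C_comp G a b u)"
proof
  assume "adjacent_to G (v i) (C_comp G a b u)"
  then have "chain G a b u v i"
    using is_chain assms unfolding chain_iff by auto
  then show False
    using no_shorter_chain assms(1) by blast
qed

lemma v_subset_S: "j \<le> k \<Longrightarrow> v ` {..<j} \<subseteq> S"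
  using v_in_S by auto

text \<open>
  An earlier chain vertex \<open>v i\<close>, \<open>i < j\<close>, has no link to \<open>v (Suc j)\<close>. The negated link gives both
  the edge \<open>v i \<rightarrow> v (Suc j)\<close> and the edges from \<open>v (Suc j)\<close> to all components at \<open>v i\<close>; the
  impossibility of starting at \<open>v (Suc j)\<close> gives those to \<open>Cab\<close>.
\<close>

lemma next_adjacent_region:
  assumes j: "j < k" and x: "x \<in> region (v ` {..<j})"
  shows "v (Suc j) \<rightarrow>\<^bsub>G\<^esub> x"
proof -
  have full: "v i \<rightarrow>\<^bsub>G\<^esub> v (Suc j)"
    "\<And>C. C \<in> comps \<Longrightarrow> adjacent_to G (v i) C \<Longrightarrow> \<not> avoided_by G (v (Suc j)) C" if "i < j" for i
    using not_link[of i "Suc j"] that j unfolding link_def by auto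
  from v_subset_S[OF less_imp_le[OF j]] x show ?thesis
  proof (cases rule: region_cases)
    case 1
    then show ?thesis
      using full adj_sym by blast
  next
    case (2 D)
    then have "\<not> avoided_by G (v (Suc j)) D"
      using full not_start[of "Suc j"] j unfolding start_def by auto
    then show ?thesis
      using 2 unfolding avoided_by_def by blast
  qed
qed

text \<open>
  In contrast to the previous lemma, the condition that admits \<open>v j\<close> to the chain yields a
  non-neighbour of \<open>v j\<close> in the same region. Together they separate \<open>v (Suc j)\<close> from \<open>v j\<close>.
\<close>

lemma misses_region:
  assumes "j \<le> k"
  shows "\<exists>x\<in>region (v ` {..<j}). \<not> v j \<rightarrow>\<^bsub>G\<^esub> x"
proof (cases j)
  case 0
  then show ?thesis
    using start_v unfolding start_def avoided_by_def region_def by auto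
next
  case (Suc i)
  then have R: "R_comp G a b (v i) \<subseteq> region (v ` {..<j})"
    unfolding region_def by auto
  have vi: "v i \<in> S"
    using v_in_S Suc assms by simp
  have "link (v i) (v j)"
    using link_v Suc assms by simp
  then consider "\<not> v i \<rightarrow>\<^bsub>G\<^esub> v j"
    | C where "C \<in> comps" "adjacent_to G (v i) C" "avoided_by G (v j) C"
    unfolding link_def by blast
  then show ?thesis
  proof cases
    case 1
    then show ?thesis
      using R R_comp_contains(1)[OF vi] adj_sym by blast
  next
    case 2
    then show ?thesis
      using R R_comp_contains(2)[OF vi] unfolding avoided_by_def by blast
  qed
qed

lemma next_fresh:
  assumes "j < k"
  shows "v (Suc j) \<notin> insert (v j) (region (v ` {..<j}))"
proof -
  have "v (Suc j) \<notin> region (v ` {..<j})"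
    using next_adjacent_region[OF assms] adj_not_same by blast
  moreover have "v (Suc j) \<noteq> v j"
    using next_adjacent_region[OF assms] misses_region[of j] assms by auto
  ultimately show ?thesis
    by blast
qed

section \<open>Sliding along the chain\<close>

text \<open>
  \<open>zone j\<close> bounds the vertices visited by the time a token stands on \<open>v j\<close>; the other token then
  stands somewhere in \<open>target j\<close>.
\<close>

abbreviation zone :: "nat \<Rightarrow> 'a set" where
  "zone j \<equiv> insert (v j) (region (v ` {..<j}))"

abbreviation target :: "nat \<Rightarrow> 'a set" where
  "target j \<equiv> if j = 0 then Cab else R_comp G a b (v (j - 1))"

lemma target_subset_region: "target j \<subseteq> region (v ` {..<j})"
  unfolding region_def by auto

text \<open>
  Inside the region of \<open>j\<close> the token on \<open>y\<close> may stand anywhere, because \<open>v (Suc j)\<close> is adjacent to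
  all of it; only the token on \<open>v j\<close> has to make way for \<open>v (Suc j)\<close>. Hence the tokens swap their
  roles in every step.
\<close>

lemma slide_to_chain_vertex:
  assumes "j \<le> k"
  shows "\<exists>y\<in>target j. y \<noteq> v j \<and> slides_within G (zone j) 1 {a, b} {v j, y}"
  using assms
proof (induction j)
  case 0
  obtain y where "y \<in> Cab" "slides_within G (insert (v 0) Cab) 1 {a, b} {v 0, y}"
    using slide_onto_common_neighbour[of "v 0"] v_in_S start_v unfolding start_def by blast
  moreover have "v 0 \<notin> Cab"
    using v_in_S[of 0] Cab_disjoint_S by blast
  ultimately show ?case
    unfolding region_def by (intro bexI[of _ y]) auto
next
  case (Suc j)
  let ?U = "region (v ` {..<j})"
  have j: "j < k" "v j \<in> S" "v (Suc j) \<in> S" "v ` {..<j} \<subseteq> S"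
    using Suc.prems v_in_S by auto
  obtain y where y: "y \<in> target j" "y \<noteq> v j" "slides_within G (zone j) 1 {a, b} {v j, y}"
    using Suc.IH j(1) less_imp_le by blast
  have yU: "y \<in> ?U"
    using y(1) target_subset_region by blast
  have y_next: "y \<rightarrow>\<^bsub>G\<^esub> v (Suc j)"
    using next_adjacent_region[OF j(1) yU] adj_sym by blast
  have zone_step: "region (v ` {..<Suc j}) = ?U \<union> R_comp G a b (v j)"
    unfolding region_def by (auto simp: lessThan_Suc)
  have vj: "v j \<in> R_comp G a b (v j)"
    by (rule R_comp_contains(1)[OF j(2)])
  have "link (v j) (v (Suc j))"
    using link_v j(1) .
  then consider "\<not> v j \<rightarrow>\<^bsub>G\<^esub> v (Suc j)"
    | C w where "C \<in> comps" "adjacent_to G (v j) C" "w \<in> C" "\<not> v (Suc j) \<rightarrow>\<^bsub>G\<^esub> w"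
    unfolding link_def avoided_by_def by blast
  then show ?case
  proof cases
    case 1
    have "slides_within G (insert (v (Suc j)) (zone j)) 1 {a, b} {v (Suc j), v j}"
      using y y_next next_fresh[OF j(1)] 1
      by (intro slides_within_move_token[where p = y]) (auto simp: insert_commute)
    then have "slides_within G (zone (Suc j)) 1 {a, b} {v (Suc j), v j}"
      by (rule slides_within_mono) (use zone_step vj in auto)
    then show ?thesis
      using vj next_fresh[OF j(1)] by (intro bexI[of _ "v j"]) auto
  next
    case (2 C w)
    have CR: "C \<subseteq> R_comp G a b (v j)"
      using R_comp_contains(2)[OF j(2)] 2 by blast
    \<comment> \<open>As \<open>v (Suc j)\<close> is adjacent to the whole region, a component that avoids it is a new one.\<close>
    have "w \<notin> ?U"
      using next_adjacent_region[OF j(1)] 2 by blast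
    then have notin: "\<not> C \<subseteq> ?U"
      using 2 by blast
    have CS: "C \<inter> S = {}"
      using comp_subset[OF 2(1)] by blast
    have "slides_within G (zone j \<union> C) 1 {a, b} {w, y}"
    proof (rule move_token_into_comp[OF y(3)])
      show "C \<inter> zone j = {}"
        using comp_outside_region(1)[OF j(4) 2(1) notin] CS j(2) by blast
      show "\<not> adjacent_to G y C"
        using comp_outside_region(2)[OF j(4) 2(1) notin yU] .
    qed (use y 2 in auto)
    then have "slides_within G (insert (v (Suc j)) (zone j \<union> C)) 1 {a, b} {v (Suc j), w}"
      using yU y_next next_fresh[OF j(1)] 2 CS j(3) \<open>w \<notin> ?U\<close> adj_sym
      by (intro slides_within_move_token[where p = y]) (auto simp: insert_commute)
    then have "slides_within G (zone (Suc j)) 1 {a, b} {v (Suc j), w}"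
      by (rule slides_within_mono) (use zone_step vj CR in auto)
    moreover have "w \<noteq> v (Suc j)"
      using 2 CS j(3) by blast
    ultimately show ?thesis
      using 2 CR by (intro bexI[of _ w]) auto
  qed
qed

text \<open>
  For \<open>u\<close> outside \<open>S\<close>, its component lies outside the region, because no chain vertex before
  \<open>v k\<close> is adjacent to it. So the token on \<open>v k\<close> can enter it and go to \<open>u\<close> without meeting \<open>y\<close>.
\<close>

lemma slide_to_u:
  assumes y: "y \<in> region (v ` {..<k})" "y \<noteq> v k"
    and slides: "slides_within G (zone k) 1 {a, b} {v k, y}"
  shows "y \<noteq> u \<and> slides G 1 {a, b} {u, y}"
proof (cases "u \<in> S")
  case True
  then have "v k = u"
    using is_chain unfolding chain_iff by auto
  then show ?thesis
    using y(2) slides_within_verts[OF slides] by blast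
next
  case False
  let ?C = "C_comp G a b u"
  have C: "?C \<in> comps" "u \<in> ?C"
    using C_comp_in_comps u False by auto
  have V: "v ` {..<k} \<subseteq> S"
    by (rule v_subset_S) simp
  have u_outside: "u \<notin> region (v ` {..<k})"
  proof
    assume "u \<in> region (v ` {..<k})"
    with V show False
    proof (cases rule: region_cases)
      case 1
      then show ?thesis
        using False V by blast
    next
      case (2 D)
      then have "D = ?C"
        using comp_eqI C by blast
      then show ?thesis
        using 2 not_end False u by auto
    qed
  qed
  then have notin: "\<not> ?C \<subseteq> region (v ` {..<k})"
    using C by blast
  have "slides_within G (zone k \<union> ?C) 1 {a, b} {u, y}"
  proof (rule move_token_into_comp[OF slides])
    show "?C \<inter> zone k = {}"
      using comp_outside_region(1)[OF V C(1) notin] comp_subset[OF C(1)] v_in_S[of k] by blast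
    show "\<not> adjacent_to G y ?C"
      using comp_outside_region(2)[OF V C(1) notin y(1)] .
    show "adjacent_to G (v k) ?C"
      using is_chain False unfolding chain_iff by auto
  qed (use y C in auto)
  then show ?thesis
    using y(1) u_outside slides_within_verts by blast
qed

end

theorem corollary3:
  fixes G :: "('a,'b) pre_digraph"
    and a b u :: 'a and v :: "nat \<Rightarrow> 'a" and k :: nat
    and X Z :: "'a set"
  assumes "graph G"
    and "a \<noteq> b" and "indep_set G {a, b}"
    and "u \<in> verts G - (C_comp G a b a \<union> C_comp G a b b)"
    and "min_length_chain G a b u v k"
    and "X = (if k = 0 then C_comp G a b a \<union> C_comp G a b b else R_comp G a b (v (k - 1)))"
    and "Z = C_comp G a b a \<union> C_comp G a b b \<union> {v k} \<union> (\<Union>i\<in>{1..k}. R_comp G a b (v (i - 1)))"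
  shows "\<exists>y\<in>X. y \<noteq> v k \<and> y \<noteq> u \<and>
           slides_within G Z 1 {a, b} {v k, y} \<and> slides G 1 {a, b} {u, y}"
proof -
  interpret graph G by fact
  interpret min_chain G a b u v k
    by unfold_locales (fact assms)+
  have "{1..k} = Suc ` {..<k}"
    by (simp add: image_Suc_lessThan)
  then have Z: "Z = zone k"
    unfolding assms(7) region_def by auto
  obtain y where y: "y \<in> target k" "y \<noteq> v k" "slides_within G (zone k) 1 {a, b} {v k, y}"
    using slide_to_chain_vertex by blast
  moreover have "y \<in> region (v ` {..<k})"
    using y(1) target_subset_region by blast
  ultimately show ?thesis
    using slide_to_u Z assms(6) by blast
qed

end
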